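(* (i) Let $(\vec\psi,\vec M)$ and $(\tilde{\vec\psi},\vec M)$ both satisfy the standing assumptions in the context, where $\tilde\psi_i=\psi_i$ for all $i\neq1$, and let $\bar P_1$ and $\tilde P_1$ denote the individual values of agent $1$ in the systems $(\vec\psi,\vec M)$ and $(\tilde{\vec\psi},\vec M)$ respectively. Suppose $\tilde\psi_1\ge\beta\psi_1$ on $X$, where $\beta>1$ is a constant. Then $$\tilde P_1\ge(\beta-1)\bar P_1 .$$ (ii) For any $\beta>2$ and any $s>\beta-1$ there exist such systems $(\vec\psi,\vec M)$ and $(\tilde{\vec\psi},\vec M)$ (both satisfying the standing assumptions, with $\tilde\psi_i=\psi_i$ for $i\ne1$) with $\tilde\psi_1\ge\beta\psi_1$, such that $$\tilde P_1<s\bar P_1 .$$ In particular, the inequality in (i) is sharp in the case $\beta>2$ (the constant $\beta-1$ cannot be replaced by a larger one).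
   Context: Setting. $I=\{1,\ldots,N\}$; $X$ is a compact Hausdorff space; $\mu$ is a probability Borel measure on $X$; $\vec\psi=(\psi_1,\ldots,\psi_N)$ with each $\psi_i:X\to\mathbb R$ continuous ("wisdom" of agent $i$); $\vec M=(M_1,\ldots,M_N)$ with $M_i>0$ ("capacities"). A "system" comprises the choice of all these data. Standing assumptions on a system $(\vec\psi,\vec M)$: (a) $\sum_{i\in I}\mu\{x;\psi_i(x)\le0\}=0$; (b) for any $r\in\mathbb R$ and any $i\ne j\in I$, $\mu\{x;\psi_i(x)-\psi_j(x)=r\}=0$; (c) in the under-saturated case $\sum_{i\in I} M_i<\mu(X)$, additionally $\mu\{x;\psi_i(x)=r\}=0$ for all $i\in I$ and all $r\in\mathbb R$. $\mathcal P_{\vec M}$ is the set of $\vec A=(A_1,\ldots,A_N)$ with $A_i\subset X$ measurable, $\mu(A_i)\le M_i$, and $\mu(A_i\cap A_j)=0$ for $i\ne j$. Under the standing assumptions there is a unique (up to $\mu$-null sets) optimal partition $(\bar A_1,\ldots,\bar A_N)\in\mathcal P_{\vec M}$, i.e. a maximizer of $\vec A\mapsto\sum_{i\in I}\int_{A_i}\psi_i\,d\mu$ over $\mathcal P_{\vec M}$. The individual value of agent $i$ in the system $(\vec\psi,\vec M)$ is $\bar P_i:=\int_{\bar A_i}\psi_i\,d\mu$. Likewise $\tilde P_1$ is $\int\tilde\psi_1\,d\mu$ over agent $1$'s share in the optimal partition of the system $(\tilde{\vec\psi},\vec M)$. *)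

theory Defs
  imports "HOL-Probability.Probability"
begin

(* A compact Hausdorff space is given as a compact subset X of a type of class t2_space, with the
   subspace topology; mu is a probability measure on the Borel sigma-algebra of X.
   The agents are the indices 1..N; psi i and M i are meaningful for these indices only. *)

definition agents :: "nat \<Rightarrow> nat set" where
  "agents N = {1..N}"

definition system_data ::
  "'a::t2_space set \<Rightarrow> 'a measure \<Rightarrow> nat \<Rightarrow> (nat \<Rightarrow> 'a \<Rightarrow> real) \<Rightarrow> (nat \<Rightarrow> real) \<Rightarrow> bool"
where
  "system_data X \<mu> N \<psi> M \<longleftrightarrow>
     1 \<le> N \<and> compact X \<and> prob_space \<mu> \<and> sets \<mu> = sets (restrict_space borel X) \<and>
     (\<forall>i\<in>agents N. continuous_on X (\<psi> i)) \<and> (\<forall>i\<in>agents N. M i > 0)"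

definition standing_assumptions ::
  "'a::t2_space set \<Rightarrow> 'a measure \<Rightarrow> nat \<Rightarrow> (nat \<Rightarrow> 'a \<Rightarrow> real) \<Rightarrow> (nat \<Rightarrow> real) \<Rightarrow> bool"
where
  "standing_assumptions X \<mu> N \<psi> M \<longleftrightarrow>
     (\<Sum>i\<in>agents N. measure \<mu> {x \<in> X. \<psi> i x \<le> 0}) = 0 \<and>
     (\<forall>r. \<forall>i\<in>agents N. \<forall>j\<in>agents N. i \<noteq> j \<longrightarrow>
        measure \<mu> {x \<in> X. \<psi> i x - \<psi> j x = r} = 0) \<and>
     ((\<Sum>i\<in>agents N. M i) < measure \<mu> X \<longrightarrow>
        (\<forall>i\<in>agents N. \<forall>r. measure \<mu> {x \<in> X. \<psi> i x = r} = 0))"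

definition subpartitions :: "'a measure \<Rightarrow> nat \<Rightarrow> (nat \<Rightarrow> real) \<Rightarrow> (nat \<Rightarrow> 'a set) set" where
  "subpartitions \<mu> N M =
     {A. (\<forall>i\<in>agents N. A i \<in> sets \<mu> \<and> measure \<mu> (A i) \<le> M i) \<and>
         (\<forall>i\<in>agents N. \<forall>j\<in>agents N. i \<noteq> j \<longrightarrow> measure \<mu> (A i \<inter> A j) = 0)}"

definition share_value :: "'a measure \<Rightarrow> (nat \<Rightarrow> 'a \<Rightarrow> real) \<Rightarrow> (nat \<Rightarrow> 'a set) \<Rightarrow> nat \<Rightarrow> real" where
  "share_value \<mu> \<psi> A i = (LINT x:A i|\<mu>. \<psi> i x)"

definition optimal_partition ::
  "'a measure \<Rightarrow> nat \<Rightarrow> (nat \<Rightarrow> 'a \<Rightarrow> real) \<Rightarrow> (nat \<Rightarrow> real) \<Rightarrow> (nat \<Rightarrow> 'a set) \<Rightarrow> bool"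
where
  "optimal_partition \<mu> N \<psi> M A \<longleftrightarrow>
     A \<in> subpartitions \<mu> N M \<and>
     (\<forall>B\<in>subpartitions \<mu> N M.
        (\<Sum>i\<in>agents N. share_value \<mu> \<psi> B i) \<le> (\<Sum>i\<in>agents N. share_value \<mu> \<psi> A i))"

(* Under the standing assumptions the optimal partition is unique up to null sets, so the
   relation below determines p. *)
definition individual_value ::
  "'a measure \<Rightarrow> nat \<Rightarrow> (nat \<Rightarrow> 'a \<Rightarrow> real) \<Rightarrow> (nat \<Rightarrow> real) \<Rightarrow> nat \<Rightarrow> real \<Rightarrow> bool"
where
  "individual_value \<mu> N \<psi> M i p \<longleftrightarrow>
     (\<exists>A. optimal_partition \<mu> N \<psi> M A \<and> p = share_value \<mu> \<psi> A i)"

definition boosted_pair ::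
  "real \<Rightarrow> 'a::t2_space set \<Rightarrow> 'a measure \<Rightarrow> nat \<Rightarrow> (nat \<Rightarrow> 'a \<Rightarrow> real) \<Rightarrow> (nat \<Rightarrow> 'a \<Rightarrow> real) \<Rightarrow>
     (nat \<Rightarrow> real) \<Rightarrow> bool"
where
  "boosted_pair \<beta> X \<mu> N \<psi> \<psi>' M \<longleftrightarrow>
     system_data X \<mu> N \<psi> M \<and> standing_assumptions X \<mu> N \<psi> M \<and>
     system_data X \<mu> N \<psi>' M \<and> standing_assumptions X \<mu> N \<psi>' M \<and>
     (\<forall>i\<in>agents N. i \<noteq> 1 \<longrightarrow> (\<forall>x\<in>X. \<psi>' i x = \<psi> i x)) \<and>
     (\<forall>x\<in>X. \<psi>' 1 x \<ge> \<beta> * \<psi> 1 x)"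

end

theory Submission imports Defs
begin

text \<open>
  For (i), test the optimal partition \<open>A\<close> of the first system against the optimal partition
  \<open>B\<close> of the second one and vice versa, and add the two inequalities. Everything except
  the contribution of agent 1 cancels, which leaves
  \<open>\<integral>\<^bsub>A 1\<^esub> (\<psi>' 1 - \<psi> 1) \<le> \<integral>\<^bsub>B 1\<^esub> (\<psi>' 1 - \<psi> 1)\<close>. The left-hand side is at
  least \<open>(\<beta> - 1) P\<close>, and the right-hand side is at most \<open>P'\<close> since \<open>\<psi> 1 > 0\<close> a.e.

  For (ii), take Lebesgue measure on the unit interval, two agents with capacities \<open>m\<close> and
  \<open>1 - m\<close>, and the affine wisdoms \<open>\<psi> 1 x = 1 - x\<close>, \<open>\<psi> 2 x = 1 - x + \<delta> x\<close> and
  \<open>\<psi>' 1 x = \<beta> - x + 2 \<delta> x\<close>. Now \<open>\<psi> 1 - \<psi> 2\<close> is strictly decreasing and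
  \<open>\<psi>' 1 - \<psi> 2\<close> is strictly increasing, so the share of agent 1 moves from \<open>[0, m]\<close> to
  \<open>[1 - m, 1]\<close>, and \<open>P' / P\<close> tends to \<open>\<beta> - 1\<close> as \<open>m\<close> and \<open>\<delta>\<close> tend to 0.
\<close>

declare One_nat_def [simp del]

section \<open>Regularity and positivity of the wisdoms\<close>

lemma finite_agents [simp]: "finite (agents N)"
  by (simp add: agents_def)

lemma system_dataD:
  assumes "system_data X \<mu> N \<psi> M"
  shows "1 \<le> N" "compact X" "prob_space \<mu>" "sets \<mu> = sets (restrict_space borel X)"
    "\<And>i. i \<in> agents N \<Longrightarrow> continuous_on X (\<psi> i)"
  using assms unfolding system_data_def by blast+

lemma one_in_agents: "system_data X \<mu> N \<psi> M \<Longrightarrow> 1 \<in> agents N"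
  using system_dataD(1) by (auto simp: agents_def)

lemma space_system_data:
  assumes "system_data X \<mu> N \<psi> M"
  shows "space \<mu> = X"
  using sets_eq_imp_space_eq[OF system_dataD(4)[OF assms]] by (simp add: space_restrict_space)

lemma measurable_wisdom:
  assumes "system_data X \<mu> N \<psi> M" "i \<in> agents N"
  shows "\<psi> i \<in> borel_measurable \<mu>"
proof -
  have "\<psi> i \<in> borel_measurable (restrict_space borel X)"
    by (intro borel_measurable_continuous_on_restrict system_dataD(5)[OF assms])
  then show ?thesis
    by (simp only: measurable_cong_sets[OF system_dataD(4)[OF assms(1)] refl])
qed

lemma integrable_wisdom:
  assumes sd: "system_data X \<mu> N \<psi> M" and i: "i \<in> agents N"
  shows "integrable \<mu> (\<psi> i)"
proof -
  interpret prob_space \<mu> by (rule system_dataD(3)[OF sd])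
  have "bounded (\<psi> i ` X)"
    using system_dataD(2,5)[OF sd] i by (intro compact_imp_bounded compact_continuous_image)
  then obtain C where "\<And>x. x \<in> X \<Longrightarrow> norm (\<psi> i x) \<le> C"
    by (auto simp: bounded_iff)
  then show ?thesis
    using measurable_wisdom[OF sd i] space_system_data[OF sd]
    by (intro integrable_const_bound[where B = C] AE_I2) auto
qed

lemma set_integrable_wisdom:
  assumes "system_data X \<mu> N \<psi> M" "i \<in> agents N" "S \<in> sets \<mu>"
  shows "set_integrable \<mu> S (\<psi> i)"
  using integrable_mult_indicator[OF assms(3) integrable_wisdom[OF assms(1,2)]]
  by (simp add: set_integrable_def)

text \<open>Assumption (a) is a vanishing sum of nonnegative terms, so every single term
  vanishes.\<close>

lemma AE_wisdom_pos:
  assumes sd: "system_data X \<mu> N \<psi> M" and sa: "standing_assumptions X \<mu> N \<psi> M"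
    and i: "i \<in> agents N"
  shows "AE x in \<mu>. \<psi> i x > 0"
proof -
  interpret prob_space \<mu> by (rule system_dataD(3)[OF sd])
  note [measurable] = measurable_wisdom[OF sd i]
  have "measure \<mu> {x \<in> X. \<psi> i x \<le> 0} = 0"
    using sa i unfolding standing_assumptions_def by (subst (asm) sum_nonneg_eq_0_iff) auto
  moreover have "{x \<in> X. \<psi> i x \<le> 0} = {x \<in> space \<mu>. \<not> \<psi> i x > 0}"
    using space_system_data[OF sd] by auto
  ultimately show ?thesis
    by (subst AE_iff_measurable[OF _ refl]) (auto simp: emeasure_eq_measure)
qed

section \<open>Part (i): exchanging the two optimal partitions\<close>

lemma boosted_individual_value_ge:
  assumes bp: "boosted_pair \<beta> X \<mu> N \<psi> \<psi>' M"
    and P: "individual_value \<mu> N \<psi> M 1 P" and P': "individual_value \<mu> N \<psi>' M 1 P'"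
  shows "(\<beta> - 1) * P \<le> P'"
proof -
  have sd: "system_data X \<mu> N \<psi> M" and sd': "system_data X \<mu> N \<psi>' M"
    and sa: "standing_assumptions X \<mu> N \<psi> M"
    and same: "\<And>i x. i \<in> agents N \<Longrightarrow> i \<noteq> 1 \<Longrightarrow> x \<in> X \<Longrightarrow> \<psi>' i x = \<psi> i x"
    and boost: "\<And>x. x \<in> X \<Longrightarrow> \<beta> * \<psi> 1 x \<le> \<psi>' 1 x"
    using bp by (auto simp: boosted_pair_def)
  note one = one_in_agents[OF sd]
  obtain A where A: "optimal_partition \<mu> N \<psi> M A" "P = share_value \<mu> \<psi> A 1"
    using P by (auto simp: individual_value_def)
  obtain B where B: "optimal_partition \<mu> N \<psi>' M B" "P' = share_value \<mu> \<psi>' B 1"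
    using P' by (auto simp: individual_value_def)
  \<comment> \<open>The capacities are shared by both systems, so \<open>A\<close> and
    \<open>B\<close> are admissible competitors in each.\<close>
  have subA: "A \<in> subpartitions \<mu> N M" and subB: "B \<in> subpartitions \<mu> N M"
    using A B by (auto simp: optimal_partition_def)
  have setsA: "A i \<in> sets \<mu>" and setsB: "B i \<in> sets \<mu>" if "i \<in> agents N" for i
    using subA subB that by (auto simp: subpartitions_def)
  have split: "(\<Sum>i\<in>agents N. share_value \<mu> \<phi> C i) =
      share_value \<mu> \<phi> C 1 + (\<Sum>i\<in>agents N - {1}. share_value \<mu> \<phi> C i)" for \<phi> C
    using one by (simp add: sum.remove)
  \<comment> \<open>Shares lie in \<open>X\<close>, where only the wisdom of agent 1 has changed;
    this makes the other agents cancel in \<open>exchange\<close>.\<close>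
  have others: "(\<Sum>i\<in>agents N - {1}. share_value \<mu> \<psi>' C i) =
      (\<Sum>i\<in>agents N - {1}. share_value \<mu> \<psi> C i)" if "C \<in> subpartitions \<mu> N M" for C
  proof (intro sum.cong refl)
    fix i assume i: "i \<in> agents N - {1}"
    then have C: "C i \<in> sets \<mu>" using that by (auto simp: subpartitions_def)
    then have "C i \<subseteq> X" using sets.sets_into_space space_system_data[OF sd] by blast
    with C i show "share_value \<mu> \<psi>' C i = share_value \<mu> \<psi> C i"
      unfolding share_value_def by (intro set_lebesgue_integral_cong) (auto simp: same)
  qed
  have "(\<Sum>i\<in>agents N. share_value \<mu> \<psi> B i) \<le> (\<Sum>i\<in>agents N. share_value \<mu> \<psi> A i)"
    "(\<Sum>i\<in>agents N. share_value \<mu> \<psi>' A i) \<le> (\<Sum>i\<in>agents N. share_value \<mu> \<psi>' B i)"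
    using A B subA subB by (auto simp: optimal_partition_def)
  then have exchange: "share_value \<mu> \<psi>' A 1 - share_value \<mu> \<psi> A 1 \<le>
      share_value \<mu> \<psi>' B 1 - share_value \<mu> \<psi> B 1"
    unfolding split others[OF subA] others[OF subB] by linarith
  have "\<beta> * share_value \<mu> \<psi> A 1 = (LINT x:A 1|\<mu>. \<beta> * \<psi> 1 x)"
    by (simp add: share_value_def)
  also have "\<dots> \<le> share_value \<mu> \<psi>' A 1"
    unfolding share_value_def
    using set_integrable_wisdom[OF sd one setsA[OF one]]
      set_integrable_wisdom[OF sd' one setsA[OF one]]
      sets.sets_into_space[OF setsA[OF one]] space_system_data[OF sd] boost
    by (intro set_integral_mono) auto
  finally have gain: "\<beta> * share_value \<mu> \<psi> A 1 \<le> share_value \<mu> \<psi>' A 1" .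
  \<comment> \<open>This quantity is subtracted on the right of \<open>exchange\<close>; dropping it
    leaves \<open>P'\<close> alone there.\<close>
  have "0 \<le> share_value \<mu> \<psi> B 1"
    unfolding share_value_def set_lebesgue_integral_def
    using AE_wisdom_pos[OF sd sa one]
    by (intro integral_nonneg_AE) (auto elim!: eventually_mono simp: indicator_def)
  then show ?thesis
    using exchange gain A(2) B(2) by (simp add: algebra_simps)
qed

section \<open>Certificates of optimality by duality\<close>

text \<open>The sum counts the shares containing \<open>x\<close>. There are finitely many pairs of
  agents, each with null overlap, so off one null set the count is 0 or 1.\<close>

lemma AE_sum_indicator_subpartition_le_1:
  assumes "finite_measure \<mu>" and C: "C \<in> subpartitions \<mu> N M"
  shows "AE x in \<mu>. (\<Sum>i\<in>agents N. indicator (C i) x) \<le> (1::real)"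
proof -
  interpret finite_measure \<mu> by fact
  have "AE x in \<mu>. \<forall>i\<in>agents N. \<forall>j\<in>agents N. i \<noteq> j \<longrightarrow> x \<notin> C i \<inter> C j"
  proof (intro AE_finite_allI finite_agents AE_impI)
    fix i j assume "i \<in> agents N" "j \<in> agents N" "i \<noteq> j"
    with C have "C i \<inter> C j \<in> null_sets \<mu>"
      by (auto simp: subpartitions_def null_sets_def emeasure_eq_measure)
    then show "AE x in \<mu>. x \<notin> C i \<inter> C j" by (rule AE_not_in)
  qed
  then show ?thesis
  proof eventually_elim
    case (elim x)
    show ?case
    proof (cases "\<exists>k\<in>agents N. x \<in> C k")
      case True
      then obtain k where k: "k \<in> agents N" "x \<in> C k" by blast
      have "(\<Sum>i\<in>agents N. indicator (C i) x) = (\<Sum>i\<in>agents N. if i = k then 1 else 0 :: real)"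
        using elim k by (intro sum.cong) (auto simp: indicator_def)
      with k show ?thesis by simp
    next
      case False
      then have "(\<Sum>i\<in>agents N. indicator (C i) x) = (0::real)"
        by (intro sum.neutral) auto
      then show ?thesis by simp
    qed
  qed
qed

text \<open>
  Linear programming duality: \<open>p\<close> consists of the prices charged to the agents, and
  \<open>u\<close> is the resulting profit.
\<close>
lemma optimal_partition_if_prices:
  assumes fin: "finite_measure \<mu>"
    and A: "A \<in> subpartitions \<mu> N M"
    and full: "\<And>i. i \<in> agents N \<Longrightarrow> measure \<mu> (A i) = M i"
    and cover: "space \<mu> \<subseteq> (\<Union>i\<in>agents N. A i)"
    and int: "\<And>i. i \<in> agents N \<Longrightarrow> integrable \<mu> (\<psi> i)"
    and u: "integrable \<mu> u" "\<And>x. x \<in> space \<mu> \<Longrightarrow> 0 \<le> u x"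
    and p: "\<And>i. i \<in> agents N \<Longrightarrow> 0 \<le> p i"
    and le: "\<And>i x. i \<in> agents N \<Longrightarrow> x \<in> space \<mu> \<Longrightarrow> \<psi> i x - p i \<le> u x"
    and eq: "\<And>i x. i \<in> agents N \<Longrightarrow> x \<in> A i \<Longrightarrow> \<psi> i x - p i = u x"
  shows "optimal_partition \<mu> N \<psi> M A"
  unfolding optimal_partition_def
proof (intro conjI ballI A)
  fix B assume B: "B \<in> subpartitions \<mu> N M"
  interpret finite_measure \<mu> by fact
  have sets: "C i \<in> sets \<mu>" if "C \<in> subpartitions \<mu> N M" "i \<in> agents N" for C i
    using that by (auto simp: subpartitions_def)
  have si: "set_integrable \<mu> (C i) f"
    if "C \<in> subpartitions \<mu> N M" "i \<in> agents N" "integrable \<mu> f" for C i and f :: "'a \<Rightarrow> real"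
    using integrable_mult_indicator[OF sets[OF that(1,2)] that(3)] by (simp add: set_integrable_def)
  have const: "(LINT x:C i|\<mu>. c) = c * measure \<mu> (C i)"
    if "C \<in> subpartitions \<mu> N M" "i \<in> agents N" for C i and c :: real
    using sets[OF that] by (simp add: set_integral_const emeasure_eq_measure)
  have profit: "(LINT x:C i|\<mu>. u x + p i) = (LINT x:C i|\<mu>. u x) + p i * measure \<mu> (C i)"
    if "C \<in> subpartitions \<mu> N M" "i \<in> agents N" for C i
    using that u by (subst set_integral_add) (auto simp: const si)
  \<comment> \<open>Gathers the profits of all shares into one integral in which \<open>u\<close> is
    weighted by the number of shares containing the point.\<close>
  have total: "(\<Sum>i\<in>agents N. LINT x:C i|\<mu>. u x) =
      (LINT x|\<mu>. (\<Sum>i\<in>agents N. indicator (C i) x) * u x)" (is ?total)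
    and total_int: "integrable \<mu> (\<lambda>x. (\<Sum>i\<in>agents N. indicator (C i) x) * u x)" (is ?int)
    if C: "C \<in> subpartitions \<mu> N M" for C
  proof -
    have i: "integrable \<mu> (\<lambda>x. indicator (C i) x * u x)" if "i \<in> agents N" for i
      using si[OF C that u(1)] by (simp add: set_integrable_def)
    show ?int
      unfolding sum_distrib_right by (intro Bochner_Integration.integrable_sum i)
    show ?total
      unfolding sum_distrib_right set_lebesgue_integral_def real_scaleR_def
      by (rule Bochner_Integration.integral_sum[symmetric]) (rule i)
  qed
  \<comment> \<open>Weak duality: any admissible \<open>B\<close> is bounded by the dual value, the
    integral of \<open>u\<close> plus the prices times the capacities.\<close>
  have "(\<Sum>i\<in>agents N. share_value \<mu> \<psi> B i) \<le> (\<Sum>i\<in>agents N. LINT x:B i|\<mu>. u x + p i)"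
    unfolding share_value_def
  proof (intro sum_mono set_integral_mono)
    fix i x assume i: "i \<in> agents N"
    show "set_integrable \<mu> (B i) (\<psi> i)" "set_integrable \<mu> (B i) (\<lambda>x. u x + p i)"
      using i B u int by (auto intro!: si)
    assume "x \<in> B i"
    then show "\<psi> i x \<le> u x + p i"
      using le[OF i, of x] sets.sets_into_space[OF sets[OF B i]] by auto
  qed
  also have "\<dots> = (LINT x|\<mu>. (\<Sum>i\<in>agents N. indicator (B i) x) * u x) +
      (\<Sum>i\<in>agents N. p i * measure \<mu> (B i))"
    by (simp add: profit[OF B] sum.distrib total[OF B])
  \<comment> \<open>The first term uses \<open>0 \<le> u\<close> and almost disjointness of the
    shares, the second nonnegative prices and the capacity bounds.\<close>
  also have "\<dots> \<le> (LINT x|\<mu>. u x) + (\<Sum>i\<in>agents N. p i * M i)"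
  proof (intro add_mono sum_mono)
    have "AE x in \<mu>. (\<Sum>i\<in>agents N. indicator (B i) x) * u x \<le> u x"
      using AE_sum_indicator_subpartition_le_1[OF fin B] AE_space
      by eventually_elim (rule mult_left_le_one_le[OF u(2) sum_nonneg], auto)
    then show "(LINT x|\<mu>. (\<Sum>i\<in>agents N. indicator (B i) x) * u x) \<le> (LINT x|\<mu>. u x)"
      by (rule integral_mono_AE[OF total_int[OF B] u(1)])
    show "p i * measure \<mu> (B i) \<le> p i * M i" if "i \<in> agents N" for i
      using that B by (intro mult_left_mono p) (auto simp: subpartitions_def)
  qed
  \<comment> \<open>Complementary slackness: for \<open>A\<close> all estimates become equalities.
    By \<open>cover\<close> the number of shares containing a point is 1 almost everywhere, by
    \<open>full\<close> the capacities are exhausted, and by \<open>eq\<close> each share earns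
    exactly \<open>u\<close>.\<close>
  also have "(LINT x|\<mu>. u x) = (LINT x|\<mu>. (\<Sum>i\<in>agents N. indicator (A i) x) * u x)"
  proof (rule integral_cong_AE)
    show "AE x in \<mu>. u x = (\<Sum>i\<in>agents N. indicator (A i) x) * u x"
      using AE_sum_indicator_subpartition_le_1[OF fin A] AE_space
    proof eventually_elim
      case (elim x)
      then obtain k where k: "k \<in> agents N" "x \<in> A k" using cover by blast
      then have "indicator (A k) x \<le> (\<Sum>i\<in>agents N. indicator (A i) x :: real)"
        by (intro member_le_sum) auto
      with k elim show ?case by simp
    qed
  qed (use u(1) total_int[OF A] in \<open>simp_all only: borel_measurable_integrable\<close>)
  also have "\<dots> + (\<Sum>i\<in>agents N. p i * M i) = (\<Sum>i\<in>agents N. LINT x:A i|\<mu>. u x + p i)"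
    by (simp add: profit[OF A] sum.distrib total[OF A] full)
  also have "\<dots> = (\<Sum>i\<in>agents N. share_value \<mu> \<psi> A i)"
    unfolding share_value_def
  proof (intro sum.cong refl set_lebesgue_integral_cong)
    fix i assume i: "i \<in> agents N"
    then show "A i \<in> sets \<mu>" by (rule sets[OF A])
    show "\<forall>x. x \<in> A i \<longrightarrow> u x + p i = \<psi> i x"
      by (simp add: eq[OF i, symmetric])
  qed
  finally show "(\<Sum>i\<in>agents N. share_value \<mu> \<psi> B i) \<le> (\<Sum>i\<in>agents N. share_value \<mu> \<psi> A i)" .
qed

section \<open>Two agents on the unit interval\<close>

abbreviation unit_lebesgue :: "real measure" where
  "unit_lebesgue \<equiv> restrict_space lborel {0..1}"

lemma sets_unit_lebesgue: "sets unit_lebesgue = sets (restrict_space borel {0..1})"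
  by (simp add: sets_restrict_space)

lemma measure_unit_lebesgue:
  "S \<subseteq> {0..1} \<Longrightarrow> measure unit_lebesgue S = measure lborel S"
  by (subst measure_restrict_space) auto

lemma prob_space_unit_lebesgue: "prob_space unit_lebesgue"
  by (intro prob_spaceI) (simp add: space_restrict_space emeasure_restrict_space)

lemma measure_unit_lebesgue_subsingleton:
  assumes "S \<subseteq> {0..1}" "S \<subseteq> {a}"
  shows "measure unit_lebesgue S = 0"
  using assms(2) unfolding measure_unit_lebesgue[OF assms(1)] subset_singleton_iff by auto

lemma two_agents: "agents 2 = {1, 2}"
  by (auto simp: agents_def)

text \<open>The exceptional sets contain at most one point, hence are null. Positivity is asked on
  [0,1) because \<open>1 - x\<close> vanishes at 1. Total capacity 1 keeps the system out of the
  under-saturated case.\<close>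

lemma two_agents_standing_assumptions:
  assumes pos: "\<And>i x. i \<in> agents 2 \<Longrightarrow> 0 \<le> x \<Longrightarrow> x < 1 \<Longrightarrow> 0 < \<psi> i x"
    and inj: "inj (\<lambda>x. \<psi> 1 x - \<psi> 2 x)"
    and sat: "M 1 + M 2 = (1::real)"
  shows "standing_assumptions {0..1} unit_lebesgue 2 \<psi> M"
proof -
  have "measure unit_lebesgue {x \<in> {0..1}. \<psi> i x \<le> 0} = 0" if i: "i \<in> agents 2" for i
    by (rule measure_unit_lebesgue_subsingleton[where a = 1]) (use pos[OF i] in force)+
  \<comment> \<open>By injectivity the preimage of \<open>r\<close> is the only candidate; if
    \<open>r\<close> is not attained, \<open>inv\<close> gives some arbitrary point and the set is
    empty.\<close>
  moreover have "measure unit_lebesgue {x \<in> {0..1}. \<psi> 1 x - \<psi> 2 x = r} = 0" for r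
    by (rule measure_unit_lebesgue_subsingleton[where a = "inv (\<lambda>x. \<psi> 1 x - \<psi> 2 x) r"])
       (use inv_f_f[OF inj] in auto)
  moreover have "{x \<in> {0..1}. \<psi> 2 x - \<psi> 1 x = r} = {x \<in> {0..1}. \<psi> 1 x - \<psi> 2 x = - r}" for r
    by auto
  moreover have "measure unit_lebesgue {0..1} = 1"
    by (simp add: measure_unit_lebesgue)
  ultimately show ?thesis
    using sat by (auto simp: standing_assumptions_def two_agents)
qed

lemma two_agents_system_data:
  assumes "\<And>i. i \<in> agents 2 \<Longrightarrow> continuous_on {0..1} (\<psi> i)" "0 < M 1" "0 < M 2"
  shows "system_data {0..1} unit_lebesgue 2 \<psi> M"
  unfolding system_data_def
  using assms prob_space_unit_lebesgue sets_unit_lebesgue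
  by (intro conjI) (auto simp: two_agents)

text \<open>Agent 1 should get the points where its advantage over agent 2 is largest. The threshold
  \<open>c\<close> is the price difference at which points on the boundary are equally profitable to
  both.\<close>

lemma two_agents_optimal_partition:
  fixes S :: "real set"
  assumes sd: "system_data {0..1} unit_lebesgue 2 \<psi> M"
    and S: "S \<in> sets borel" "S \<subseteq> {0..1}" "measure lborel S = M 1"
    and sat: "M 1 + M 2 = 1"
    and nonneg: "\<And>i x. i \<in> agents 2 \<Longrightarrow> 0 \<le> x \<Longrightarrow> x \<le> 1 \<Longrightarrow> 0 \<le> \<psi> i x"
    and thr: "\<And>x. x \<in> S \<Longrightarrow> c \<le> \<psi> 1 x - \<psi> 2 x"
      "\<And>x. x \<in> {0..1} - S \<Longrightarrow> \<psi> 1 x - \<psi> 2 x \<le> c"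
  shows "optimal_partition unit_lebesgue 2 \<psi> M (\<lambda>i. if i = 1 then S else {0..1} - S)"
proof -
  interpret prob_space unit_lebesgue by (rule prob_space_unit_lebesgue)
  \<comment> \<open>The positive and negative parts of \<open>c\<close>: both are nonnegative and
    their difference is \<open>c\<close>. One of them is 0, so nonnegative wisdoms make the best
    profit \<open>u\<close> nonnegative.\<close>
  define p where "p i = (if i = 1 then max c 0 else max (- c) 0)" for i :: nat
  define u where "u x = max (\<psi> 1 x - p 1) (\<psi> 2 x - p 2)" for x
  have space: "space unit_lebesgue = {0..1}"
    by (simp add: space_restrict_space)
  have S': "S \<in> sets unit_lebesgue"
    using S by (auto simp: sets_restrict_space)
  have m1: "measure unit_lebesgue S = M 1"
    using S by (simp add: measure_unit_lebesgue)
  then have m2: "measure unit_lebesgue ({0..1} - S) = M 2"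
    using prob_compl[OF S'] sat by (simp add: space)
  show ?thesis
  proof (rule optimal_partition_if_prices[where p = p and u = u])
    show "(\<lambda>i. if i = 1 then S else {0..1} - S) \<in> subpartitions unit_lebesgue 2 M"
      using S' m1 m2 sets.compl_sets[OF S']
      by (auto simp: subpartitions_def two_agents space Int_Diff Diff_Int_distrib2)
    show "integrable unit_lebesgue (\<psi> i)" if "i \<in> agents 2" for i
      using integrable_wisdom[OF sd that] .
    then show "integrable unit_lebesgue u"
      unfolding u_def by (intro integrable_max) (auto simp: two_agents)
    show "0 \<le> u x" if "x \<in> space unit_lebesgue" for x
      using nonneg[of 1 x] nonneg[of 2 x] that
      by (auto simp: u_def p_def space two_agents max_def split: if_splits)
    show "\<psi> i x - p i = u x" if "i \<in> agents 2" "x \<in> (if i = 1 then S else {0..1} - S)" for i x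
      using that thr[of x] by (auto simp: two_agents u_def p_def max_def)
  qed (use m1 m2 thr in \<open>auto simp: finite_measure_axioms two_agents space u_def p_def max_def\<close>)
qed

section \<open>Part (ii): the extremal family of examples\<close>

lemma boosted_pair_below_ratio:
  fixes \<beta> s :: real
  assumes beta: "1 < \<beta>" and s: "\<beta> - 1 < s"
  shows "\<exists>\<psi> \<psi>' M P P'. boosted_pair \<beta> {0..1} unit_lebesgue 2 \<psi> \<psi>' M \<and>
    individual_value unit_lebesgue 2 \<psi> M 1 P \<and> individual_value unit_lebesgue 2 \<psi>' M 1 P' \<and>
    P' < s * P"
proof -
  \<comment> \<open>With the gap \<open>s - (\<beta> - 1)\<close>, these choices make
    \<open>2 * \<delta>\<close> at most half and \<open>m * (1 + s)\<close> at most a quarter of it,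
    which leaves room for the strict final estimate. The cap on \<open>m\<close> keeps the capacity
    of agent 2 positive.\<close>
  define \<delta> where "\<delta> = min (1/2) ((s - (\<beta> - 1)) / 4)"
  define m where "m = min (1/2) ((s - (\<beta> - 1)) / (4 * (1 + s)))"
  \<comment> \<open>Up to terms in \<delta> the two agents differ by a constant, both before and
    after the boost. The small tilts alone decide which end agent 1 gets: first the left one, where
    \<open>\<psi> 1\<close> is near 1, then the right one, where \<open>\<psi>' 1\<close> is near
    \<open>\<beta> - 1\<close>.\<close>
  define \<psi> where "\<psi> i x = (if i = 1 then 1 - x else 1 - x + \<delta> * x)" for i :: nat and x :: real
  define \<psi>' where "\<psi>' i x = (if i = 1 then \<beta> - x + 2 * \<delta> * x else 1 - x + \<delta> * x)"
    for i :: nat and x :: real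
  define M where "M i = (if i = 1 then m else 1 - m)" for i :: nat
  define A where "A = (\<lambda>i::nat. if i = 1 then {0..m} else {0..1} - {0..m})"
  define B where "B = (\<lambda>i::nat. if i = 1 then {1 - m..1} else {0..1} - {1 - m..1})"
  have \<delta>: "0 < \<delta>" "\<delta> \<le> 1/2" "4 * \<delta> \<le> s - (\<beta> - 1)"
    using s by (auto simp: \<delta>_def min_def)
  have m: "0 < m" "m \<le> 1/2" "m \<le> (s - (\<beta> - 1)) / (4 * (1 + s))"
    using s beta by (auto simp: m_def)
  then have ms: "4 * (m * (1 + s)) \<le> s - (\<beta> - 1)"
    using s beta by (simp add: field_simps)
  interpret prob_space unit_lebesgue by (rule prob_space_unit_lebesgue)
  have pos: "0 < 1 - x + \<delta> * x" "0 < \<beta> - x + 2 * \<delta> * x" if "0 \<le> x" "x \<le> 1" for x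
  proof -
    have "0 \<le> \<delta> * x" using that \<delta> by simp
    then show "0 < \<beta> - x + 2 * \<delta> * x" using that beta by linarith
    show "0 < 1 - x + \<delta> * x"
    proof (cases "x = 1")
      case False
      with that \<open>0 \<le> \<delta> * x\<close> show ?thesis by linarith
    qed (use \<delta> in simp)
  qed
  have sd: "system_data {0..1} unit_lebesgue 2 \<psi> M"
    using m
    by (intro two_agents_system_data)
       (auto simp: \<psi>_def M_def two_agents intro!: continuous_intros)
  have sd': "system_data {0..1} unit_lebesgue 2 \<psi>' M"
    using m
    by (intro two_agents_system_data)
       (auto simp: \<psi>'_def M_def two_agents intro!: continuous_intros)
  have sa: "standing_assumptions {0..1} unit_lebesgue 2 \<psi> M"
    using \<delta> pos
    by (intro two_agents_standing_assumptions) (auto simp: \<psi>_def M_def two_agents inj_def)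
  have sa': "standing_assumptions {0..1} unit_lebesgue 2 \<psi>' M"
  proof (intro two_agents_standing_assumptions)
    have "\<psi>' 1 x - \<psi>' 2 x = \<beta> - 1 + \<delta> * x" for x by (simp add: \<psi>'_def)
    then show "inj (\<lambda>x. \<psi>' 1 x - \<psi>' 2 x)" using \<delta> by (simp add: inj_def)
  qed (use pos in \<open>auto simp: \<psi>'_def M_def two_agents\<close>)
  have boost: "\<beta> * \<psi> 1 x \<le> \<psi>' 1 x" if "x \<in> {0..1}" for x
  proof -
    have "\<psi>' 1 x - \<beta> * \<psi> 1 x = (\<beta> - 1) * x + 2 * \<delta> * x"
      by (simp add: \<psi>_def \<psi>'_def algebra_simps)
    moreover have "0 \<le> (\<beta> - 1) * x + 2 * \<delta> * x"
      using that beta \<delta> by auto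
    ultimately show ?thesis by linarith
  qed
  have bp: "boosted_pair \<beta> {0..1} unit_lebesgue 2 \<psi> \<psi>' M"
    using sd sd' sa sa' boost by (auto simp: boosted_pair_def \<psi>_def \<psi>'_def)
  \<comment> \<open>The threshold is the value of \<open>\<psi> 1 - \<psi> 2\<close> at the endpoint
    \<open>m\<close> of the share.\<close>
  have optA: "optimal_partition unit_lebesgue 2 \<psi> M A"
    unfolding A_def
    using m \<delta> less_imp_le[OF pos(1)]
    by (intro two_agents_optimal_partition[where c = "- \<delta> * m"] sd)
       (auto simp: \<psi>_def M_def two_agents)
  have optB: "optimal_partition unit_lebesgue 2 \<psi>' M B"
    unfolding B_def
  \<comment> \<open>Again the value at the boundary point, now \<open>1 - m\<close>, of the
    increasing difference \<open>\<psi>' 1 - \<psi>' 2\<close>.\<close>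
  proof (intro two_agents_optimal_partition[where c = "\<beta> - 1 + \<delta> * (1 - m)"] sd')
    have d: "\<psi>' 1 x - \<psi>' 2 x = \<beta> - 1 + \<delta> * x" for x by (simp add: \<psi>'_def)
    show "\<beta> - 1 + \<delta> * (1 - m) \<le> \<psi>' 1 x - \<psi>' 2 x" if "x \<in> {1 - m..1}" for x
      using that \<delta> unfolding d by (intro add_left_mono mult_left_mono) auto
    show "\<psi>' 1 x - \<psi>' 2 x \<le> \<beta> - 1 + \<delta> * (1 - m)" if "x \<in> {0..1} - {1 - m..1}" for x
      using that \<delta> unfolding d by (intro add_left_mono mult_left_mono) auto
  qed (use m less_imp_le[OF pos(1)] less_imp_le[OF pos(2)] in
      \<open>auto simp: \<psi>'_def M_def two_agents\<close>)
  have A1: "A 1 \<in> sets unit_lebesgue" and B1: "B 1 \<in> sets unit_lebesgue"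
    using optA optB by (auto simp: optimal_partition_def subpartitions_def two_agents)
  have mA: "measure unit_lebesgue (A 1) = m" and mB: "measure unit_lebesgue (B 1) = m"
    using m by (auto simp: A_def B_def measure_unit_lebesgue)
  have const: "(LINT x:S|unit_lebesgue. c) = measure unit_lebesgue S * c"
    "set_integrable unit_lebesgue S (\<lambda>x. c)"
    if "S \<in> sets unit_lebesgue" for S and c :: real
    using that by (auto simp: set_integral_const emeasure_eq_measure set_integrable_def)
  \<comment> \<open>Both values are compared with constants: \<open>\<psi> 1\<close> is at least its
    value at \<open>m\<close>, and below \<open>\<psi>' 1\<close> is bounded by taking
    \<open>x\<close> as \<open>1 - m\<close> in \<open>- x\<close> and as 1 in the
    \<delta>-term.\<close>
  have "m * (1 - m) = (LINT x:A 1|unit_lebesgue. 1 - m)"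
    using const[OF A1] mA by simp
  also have "\<dots> \<le> share_value unit_lebesgue \<psi> A 1"
    unfolding share_value_def
    by (intro set_integral_mono const(2) A1 set_integrable_wisdom[OF sd])
       (auto simp: A_def \<psi>_def two_agents)
  finally have lower: "m * (1 - m) \<le> share_value unit_lebesgue \<psi> A 1" .
  have "share_value unit_lebesgue \<psi>' B 1 \<le> (LINT x:B 1|unit_lebesgue. \<beta> - 1 + m + 2 * \<delta>)"
    unfolding share_value_def
  proof (intro set_integral_mono const(2) B1 set_integrable_wisdom[OF sd'])
    fix x assume "x \<in> B 1"
    then have x: "1 - m \<le> x" "x \<le> 1" by (auto simp: B_def)
    then have "\<delta> * x \<le> \<delta>" using \<delta> by simp
    then show "\<psi>' 1 x \<le> \<beta> - 1 + m + 2 * \<delta>" using x by (simp add: \<psi>'_def)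
  qed (simp add: two_agents)
  also have "\<dots> = m * (\<beta> - 1 + m + 2 * \<delta>)"
    using const[OF B1] mB by simp
  also have "\<dots> < m * (s * (1 - m))"
  proof (intro mult_strict_left_mono m)
    have "4 * m + 4 * (s * m) \<le> s - (\<beta> - 1)"
      using ms by (simp add: algebra_simps)
    then show "\<beta> - 1 + m + 2 * \<delta> < s * (1 - m)"
      using \<delta>(3) s by (simp add: right_diff_distrib)
  qed
  also have "\<dots> = s * (m * (1 - m))"
    by simp
  also have "\<dots> \<le> s * share_value unit_lebesgue \<psi> A 1"
    using lower s beta by (intro mult_left_mono) auto
  finally show ?thesis
    using bp optA optB unfolding individual_value_def by blast
qed

section \<open>Both parts together, and optimality of the constant\<close>

theorem theorem3:
  "(\<forall>\<beta>>1. \<forall>(X :: 'a::t2_space set) \<mu> N \<psi> \<psi>' M P P'.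
      boosted_pair \<beta> X \<mu> N \<psi> \<psi>' M \<and>
      individual_value \<mu> N \<psi> M 1 P \<and> individual_value \<mu> N \<psi>' M 1 P' \<longrightarrow>
      P' \<ge> (\<beta> - 1) * P) \<and>
   (\<forall>\<beta>>2. \<forall>s>\<beta> - 1. \<exists>(X :: real set) \<mu> N \<psi> \<psi>' M P P'.
      boosted_pair \<beta> X \<mu> N \<psi> \<psi>' M \<and>
      individual_value \<mu> N \<psi> M 1 P \<and> individual_value \<mu> N \<psi>' M 1 P' \<and>
      P' < s * P) \<and>
   (\<forall>\<beta>>2. \<forall>c.
      (\<forall>(X :: real set) \<mu> N \<psi> \<psi>' M P P'.
         boosted_pair \<beta> X \<mu> N \<psi> \<psi>' M \<and>
         individual_value \<mu> N \<psi> M 1 P \<and> individual_value \<mu> N \<psi>' M 1 P' \<longrightarrow>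
         P' \<ge> c * P) \<longrightarrow>
      c \<le> \<beta> - 1)"
proof (intro conjI)
  show "\<forall>\<beta>>1. \<forall>(X :: 'a set) \<mu> N \<psi> \<psi>' M P P'.
      boosted_pair \<beta> X \<mu> N \<psi> \<psi>' M \<and>
      individual_value \<mu> N \<psi> M 1 P \<and> individual_value \<mu> N \<psi>' M 1 P' \<longrightarrow>
      P' \<ge> (\<beta> - 1) * P"
    by (intro allI impI, elim conjE) (rule boosted_individual_value_ge)
  show sharp: "\<forall>\<beta>>2. \<forall>s>\<beta> - 1. \<exists>(X :: real set) \<mu> N \<psi> \<psi>' M P P'.
      boosted_pair \<beta> X \<mu> N \<psi> \<psi>' M \<and>
      individual_value \<mu> N \<psi> M 1 P \<and> individual_value \<mu> N \<psi>' M 1 P' \<and> P' < s * P"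
  proof (intro allI impI)
    fix \<beta> s :: real assume "2 < \<beta>" "\<beta> - 1 < s"
    moreover from this have "1 < \<beta>" by simp
    ultimately show "\<exists>(X :: real set) \<mu> N \<psi> \<psi>' M P P'.
      boosted_pair \<beta> X \<mu> N \<psi> \<psi>' M \<and>
      individual_value \<mu> N \<psi> M 1 P \<and> individual_value \<mu> N \<psi>' M 1 P' \<and> P' < s * P"
      using boosted_pair_below_ratio[of \<beta> s] by blast
  qed
  show "\<forall>\<beta>>2. \<forall>c.
      (\<forall>(X :: real set) \<mu> N \<psi> \<psi>' M P P'.
         boosted_pair \<beta> X \<mu> N \<psi> \<psi>' M \<and>
         individual_value \<mu> N \<psi> M 1 P \<and> individual_value \<mu> N \<psi>' M 1 P' \<longrightarrow>
         P' \<ge> c * P) \<longrightarrow>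
      c \<le> \<beta> - 1"
  \<comment> \<open>A constant \<open>c\<close> beyond \<open>\<beta> - 1\<close> can serve as
    \<open>s\<close> in \<open>sharp\<close>, whose example violates the supposed bound.\<close>
  proof (intro allI impI, rule ccontr)
    fix \<beta> c :: real
    assume "2 < \<beta>" and bound: "\<forall>(X :: real set) \<mu> N \<psi> \<psi>' M P P'.
         boosted_pair \<beta> X \<mu> N \<psi> \<psi>' M \<and>
         individual_value \<mu> N \<psi> M 1 P \<and> individual_value \<mu> N \<psi>' M 1 P' \<longrightarrow>
         P' \<ge> c * P"
      and "\<not> c \<le> \<beta> - 1"
    then have "\<beta> - 1 < c" by simp
    with sharp \<open>2 < \<beta>\<close> obtain X :: "real set" and \<mu> N \<psi> \<psi>' M P P' where
      "boosted_pair \<beta> X \<mu> N \<psi> \<psi>' M" "individual_value \<mu> N \<psi> M 1 P"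
      "individual_value \<mu> N \<psi>' M 1 P'" "P' < c * P"
      by blast
    with bound show False by (meson not_le)
  qed
qed

end
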